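(* Let $K$ be a field, let $S=K[x_1,\dots,x_n]$ be the polynomial ring, let $\mathfrak{m}=(x_1,\dots,x_n)$, and let $I\subset S$ be a monomial ideal. Then $\mathfrak{m}^kI$ has linear quotients for all $k\gg 0$; that is, there exists an integer $k_0$ such that $\mathfrak{m}^kI$ has linear quotients for every $k\ge k_0$.
   Context: For a monomial ideal $J\subset S$, $G(J)$ denotes its unique minimal set of monomial generators. The ideal $J$ is said to have linear quotients if there exists an ordering $u_1<\cdots<u_r$ of the elements of $G(J)$ such that for each $2\le i\le r$ the colon ideal $(u_1,\dots,u_{i-1}):u_i$ is generated by a subset of the variables $x_1,\dots,x_n$. *)

theory Defs
  imports Complex_Main "HOL-Library.Poly_Mapping"
begin

(* A commutative ring is a module over itself; its submodules are the ideals, so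
   ideal.subspace J says that J is an ideal and ideal.span B is the ideal generated by B. *)
global_interpretation ideal: module "(*) :: 'a::comm_ring_1 \<Rightarrow> 'a \<Rightarrow> 'a"
  by unfold_locales (simp_all add: algebra_simps)

definition ideal_mult :: "'a::comm_ring_1 set \<Rightarrow> 'a set \<Rightarrow> 'a set" where
  "ideal_mult I J = ideal.span {a * b | a b. a \<in> I \<and> b \<in> J}"

primrec ideal_power :: "'a::comm_ring_1 set \<Rightarrow> nat \<Rightarrow> 'a set" where
  "ideal_power I 0 = UNIV"
| "ideal_power I (Suc k) = ideal_mult I (ideal_power I k)"

definition ideal_colon :: "'a::comm_ring_1 set \<Rightarrow> 'a \<Rightarrow> 'a set" where
  "ideal_colon J u = {f. f * u \<in> J}"

(* K[x_i : i in 'n]: finitely supported functions from exponent vectors to K,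
   with the convolution product of Poly_Mapping. *)
type_synonym ('n, 'k) mvpoly = "('n \<Rightarrow>\<^sub>0 nat) \<Rightarrow>\<^sub>0 'k"

definition monomial :: "('n \<Rightarrow>\<^sub>0 nat) \<Rightarrow> ('n, 'k::field) mvpoly" where
  "monomial a = Poly_Mapping.single a 1"

definition variable :: "'n \<Rightarrow> ('n, 'k::field) mvpoly" where
  "variable i = monomial (Poly_Mapping.single i 1)"

definition max_ideal :: "('n, 'k::field) mvpoly set" where
  "max_ideal = ideal.span (range variable)"

definition monomial_ideal :: "('n, 'k::field) mvpoly set \<Rightarrow> bool" where
  "monomial_ideal J \<longleftrightarrow> (\<exists>M \<subseteq> range monomial. J = ideal.span M)"

definition minimal_monomial_generators ::
    "('n, 'k::field) mvpoly set \<Rightarrow> ('n, 'k) mvpoly set \<Rightarrow> bool" where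
  "minimal_monomial_generators J G \<longleftrightarrow>
     G \<subseteq> range monomial \<and> ideal.span G = J \<and> (\<forall>H. H \<subset> G \<longrightarrow> ideal.span H \<noteq> J)"

(* Meaningful for monomial ideals only: see ex1_minimal_monomial_generators below. *)
definition mingens :: "('n, 'k::field) mvpoly set \<Rightarrow> ('n, 'k) mvpoly set" where
  "mingens J = (THE G. minimal_monomial_generators J G)"

(* List positions start at 0, so us ! i is u_(i+1) and take i us is u_1, ..., u_i. *)
definition linear_quotients :: "('n, 'k::field) mvpoly set \<Rightarrow> bool" where
  "linear_quotients J \<longleftrightarrow>
     (\<exists>us. distinct us \<and> set us = mingens J \<and>
        (\<forall>i. 1 \<le> i \<and> i < length us \<longrightarrow>
           (\<exists>V. ideal_colon (ideal.span (set (take i us))) (us ! i) = ideal.span (variable ` V))))"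

lemma monomial_add: "monomial (a + b) = monomial a * monomial b"
  by (simp add: monomial_def mult_single)

lemma keys_monomial [simp]: "Poly_Mapping.keys (monomial a :: ('n, 'k::field) mvpoly) = {a}"
  by (simp add: monomial_def)

lemma monomial_in_spanD:
  assumes "(monomial b :: ('n, 'k::field) mvpoly) \<in> ideal.span (monomial ` A)"
  shows "\<exists>a\<in>A. \<exists>c. b = a + c"
proof -
  let ?T = "{f :: ('n, 'k) mvpoly. \<forall>b \<in> Poly_Mapping.keys f. \<exists>a\<in>A. \<exists>c. b = a + c}"
  have "ideal.subspace ?T"
  proof (rule ideal.subspaceI)
    fix f g :: "('n, 'k) mvpoly"
    show "0 \<in> ?T" by simp
    show "f + g \<in> ?T" if "f \<in> ?T" "g \<in> ?T"
      using that Poly_Mapping.keys_add[of f g] by blast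
    show "f * g \<in> ?T" if "g \<in> ?T"
    proof safe
      fix b assume "b \<in> Poly_Mapping.keys (f * g)"
      then obtain p q where "b = p + q" "q \<in> Poly_Mapping.keys g"
        using Poly_Mapping.keys_mult[of f g] by blast
      moreover from this that obtain a c where "a \<in> A" "q = a + c" by blast
      ultimately have "b = a + (p + c)" by (simp add: ac_simps)
      with \<open>a \<in> A\<close> show "\<exists>a\<in>A. \<exists>c. b = a + c" by blast
    qed
  qed
  moreover have "monomial ` A \<subseteq> ?T"
    by auto (metis add.right_neutral)
  ultimately have "ideal.span (monomial ` A) \<subseteq> ?T"
    by (rule ideal.span_minimal[rotated])
  with assms show ?thesis by auto
qed

lemma ex1_minimal_monomial_generators:
  fixes J :: "('n::finite, 'k::field) mvpoly set"
  assumes "monomial_ideal J"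
  shows "\<exists>!G. minimal_monomial_generators J G"
proof -
  define m :: "('n \<Rightarrow>\<^sub>0 nat) \<Rightarrow> ('n, 'k) mvpoly" where "m = monomial"
  define d :: "('n \<Rightarrow>\<^sub>0 nat) \<Rightarrow> nat" where "d a = (\<Sum>i\<in>UNIV. Poly_Mapping.lookup a i)" for a
  have d_add: "d (a + b) = d a + d b" for a b
    by (simp add: d_def lookup_add sum.distrib)
  have d_0: "b = 0" if "d b = 0" for b
    using that by (auto simp: d_def intro: poly_mapping_eqI)
  have spanD: "\<exists>a\<in>A. \<exists>c. b = a + c" if "m b \<in> ideal.span (m ` A)" for b A
    using monomial_in_spanD that unfolding m_def by blast
  have spanI: "m (a + c) \<in> ideal.span (m ` A)" if "a \<in> A" for a c A
  proof -
    have "m (a + c) = m c * m a"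
      by (simp add: m_def monomial_add mult.commute)
    with that show ?thesis
      by (simp add: ideal.span_scale ideal.span_base)
  qed
  have anti: "a = b" if "a = b + c" "b = a + e" for a b c e :: "'n \<Rightarrow>\<^sub>0 nat"
  proof -
    have "d a = d b + d c" "d b = d a + d e"
      using that(1) d_add[of b c] that(2) d_add[of a e] by argo+
    then have "c = 0" using d_0 by simp
    with that(1) show ?thesis by simp
  qed
  obtain M where M: "M \<subseteq> range m" "J = ideal.span M"
    using assms by (auto simp: monomial_ideal_def m_def)
  then obtain A0 where A0: "J = ideal.span (m ` A0)"
    by (auto elim!: subset_imageE)
  define A where "A = {a \<in> A0. \<forall>b\<in>A0. \<forall>c. a = b + c \<longrightarrow> b = a}"
  have below: "\<exists>b\<in>A. \<exists>c. a = b + c" if "a \<in> A0" for a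
    using that
  proof (induction "d a" arbitrary: a rule: less_induct)
    case less
    show ?case
    proof (cases "a \<in> A")
      case True
      then show ?thesis by (intro bexI[of _ a] exI[of _ 0]) auto
    next
      case False
      then obtain b c where bc: "b \<in> A0" "a = b + c" "b \<noteq> a"
        using less.prems by (auto simp: A_def)
      then have "d b < d a" using d_0[of c] by (cases "d c = 0") (auto simp: d_add)
      with less.hyps bc obtain b' c' where "b' \<in> A" "b = b' + c'" by blast
      with bc show ?thesis by (metis add.assoc)
    qed
  qed
  have "m ` A0 \<subseteq> ideal.span (m ` A)"
  proof
    fix f assume "f \<in> m ` A0"
    then obtain a where "a \<in> A0" "f = m a" by blast
    with below obtain b c where "b \<in> A" "f = m (b + c)" by blast
    with spanI show "f \<in> ideal.span (m ` A)" by blast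
  qed
  then have J: "J = ideal.span (m ` A)"
  proof (intro subset_antisym)
    show "J \<subseteq> ideal.span (m ` A)"
      unfolding A0 by (intro ideal.span_minimal ideal.subspace_span) fact
    show "ideal.span (m ` A) \<subseteq> J"
      unfolding A0 by (intro ideal.span_mono image_mono) (auto simp: A_def)
  qed
  have ex: "minimal_monomial_generators J (m ` A)"
    unfolding minimal_monomial_generators_def
  proof (intro conjI allI impI)
    show "m ` A \<subseteq> range monomial" by (auto simp: m_def)
    show "ideal.span (m ` A) = J" using J by simp
    fix H assume H: "H \<subset> m ` A"
    then obtain B where B: "H = m ` B" "B \<subset> A"
      by (auto simp: psubset_eq elim!: subset_imageE)
    then obtain a where a: "a \<in> A" "a \<notin> B" by blast
    show "ideal.span H \<noteq> J"
    proof
      assume "ideal.span H = J"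
      then have "m a \<in> ideal.span (m ` B)"
        using a(1) J B(1) ideal.span_base[of "m a" "m ` A"] by auto
      then obtain b c where bc: "b \<in> B" "a = b + c" using spanD by blast
      with a B have "b = a" unfolding A_def by blast
      with bc(1) a(2) show False by simp
    qed
  qed
  have sub: "B \<subseteq> C" if B: "minimal_monomial_generators J (m ` B)"
    and C: "minimal_monomial_generators J (m ` C)" for B C
  proof
    fix a assume a: "a \<in> B"
    have JB: "ideal.span (m ` B) = J" and JC: "ideal.span (m ` C) = J"
      using B C by (auto simp: minimal_monomial_generators_def)
    have inj: "inj m"
      by (rule injI) (metis keys_monomial m_def singleton_inject)
    have "m a \<in> ideal.span (m ` C)" 
      using a JB JC ideal.span_base[of "m a" "m ` B"] by auto
    then obtain b c where b: "b \<in> C" "a = b + c" using spanD by blast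
    have "m b \<in> ideal.span (m ` B)" 
      using b(1) JB JC ideal.span_base[of "m b" "m ` C"] by auto
    then obtain a' c' where a': "a' \<in> B" "b = a' + c'" using spanD by blast
    have "a' = a"
    proof (rule ccontr)
      assume ne: "a' \<noteq> a"
      have "m a \<in> ideal.span (m ` (B - {a}))"
        using spanI[of a' "B - {a}" "c' + c"] a' b ne by (simp add: add.assoc)
      moreover have "m x \<in> ideal.span (m ` (B - {a}))" if "x \<in> B" "x \<noteq> a" for x
        by (rule ideal.span_base) (use that in blast)
      ultimately have "m ` B \<subseteq> ideal.span (m ` (B - {a}))"
        by blast
      then have "ideal.span (m ` (B - {a})) = J"
        using JB ideal.span_minimal[OF _ ideal.subspace_span]
          ideal.span_mono[of "m ` (B - {a})" "m ` B"] by blast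
      moreover have "m ` (B - {a}) \<subset> m ` B"
        using a by (auto simp: image_iff dest: injD[OF inj])
      ultimately show False using B by (auto simp: minimal_monomial_generators_def)
    qed
    with a' have "b = a + c'" by simp
    with b(2) have "a = b" by (rule anti)
    with b(1) show "a \<in> C" by simp
  qed
  show ?thesis
  proof (rule ex1I, rule ex)
    fix G assume G: "minimal_monomial_generators J G"
    then obtain B where "G = m ` B"
      by (auto simp: minimal_monomial_generators_def m_def elim: subset_imageE)
    with G ex sub[of A B] sub[of B A] show "G = m ` A" by blast
  qed
qed

end

theory Submission
  imports Defs "HOL-Library.Product_Lexorder"
begin

text \<open>A monomial \<open>x\<^sup>b\<close> lies in \<open>\<mm>\<^sup>k I\<close> iff some generator \<open>x\<^sup>a\<close> of \<open>I\<close> divides it and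
  \<open>deg b \<ge> deg a + k\<close>. By Dickson's lemma finitely many generators suffice, so their exponents have
  a common bound \<open>M\<close>. Then whether \<open>x\<^sup>a\<close> divides \<open>x\<^sup>b\<close> depends only on \<open>b\<close> truncated at \<open>M\<close> in each
  coordinate. If \<open>k > n M\<close>, every monomial \<open>u\<close> in \<open>\<mm>\<^sup>k I\<close> has an exponent \<open>u\<^sub>j > M\<close>, and one unit can be
  moved from \<open>j\<close> to any other index \<open>i\<close> without leaving \<open>\<mm>\<^sup>k I\<close>: the resulting
  \<open>x\<^sub>i u / x\<^sub>j\<close> has the same degree and is still divisible by the generators of \<open>I\<close> that divide \<open>u\<close>.

  Order the minimal generators of \<open>\<mm>\<^sup>k I\<close> by increasing degree, then by decreasing truncated degree
  \<open>\<Sum>\<^sub>i min(u\<^sub>i, M)\<close>, then by decreasing weighted sum \<open>\<Sum>\<^sub>i w\<^sub>i u\<^sub>i\<close> for pairwise different weights.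
  The colon ideals are generated by variables as soon as, for every \<open>v\<close> before \<open>u\<close>, there is an index
  \<open>i\<close> with \<open>v\<^sub>i > u\<^sub>i\<close> such that a generator before \<open>u\<close> divides \<open>x\<^sub>i u\<close>
  (\<open>ideal_colon_variables\<close>). Such a generator is found below a suitable \<open>x\<^sub>i u / x\<^sub>j\<close> with \<open>u\<^sub>j > M\<close>
  (\<open>raised_exps_linear_step\<close>):

  \<^item> If \<open>v\<^sub>i > u\<^sub>i\<close> for some \<open>i\<close> with \<open>u\<^sub>i < M\<close>, moving a unit from \<open>j\<close> to \<open>i\<close> increases the truncated
    degree, so it leads to an earlier monomial.

  \<^item> Otherwise \<open>v\<close> truncated at \<open>M\<close> divides \<open>u\<close>, hence so does a generator of \<open>I\<close> of degree at
    most \<open>deg v - k\<close>. Minimality of \<open>u\<close> gives \<open>deg u \<le> deg v\<close>, and since \<open>v\<close> comes first, the degrees and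
    then the truncations of \<open>u\<close> and \<open>v\<close> agree. So \<open>u\<close> and \<open>v\<close> differ only in exponents that are at
    least \<open>M\<close>, and comparing the weighted sums yields \<open>i\<close> and \<open>j\<close> with
    \<open>v\<^sub>i > u\<^sub>i\<close>, \<open>v\<^sub>j < u\<^sub>j\<close> and \<open>w\<^sub>i > w\<^sub>j\<close>; moving a unit from \<open>j\<close> to \<open>i\<close> keeps the truncation and
    increases the weighted sum.\<close>

section \<open>Exponent vectors\<close>

text \<open>Divisibility of monomials. The library's order on finitely supported functions is the
  lexicographic one, hence the separate symbol.\<close>

definition exp_le :: "('n \<Rightarrow>\<^sub>0 nat) \<Rightarrow> ('n \<Rightarrow>\<^sub>0 nat) \<Rightarrow> bool"  (infix "\<preceq>" 50) where
  "a \<preceq> b \<longleftrightarrow> (\<forall>i. Poly_Mapping.lookup a i \<le> Poly_Mapping.lookup b i)"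

definition total_degree :: "('n::finite \<Rightarrow>\<^sub>0 nat) \<Rightarrow> nat" where
  "total_degree a = (\<Sum>i\<in>UNIV. Poly_Mapping.lookup a i)"

definition minimal_exps :: "('n \<Rightarrow>\<^sub>0 nat) set \<Rightarrow> ('n \<Rightarrow>\<^sub>0 nat) set" where
  "minimal_exps P = {a \<in> P. \<forall>b\<in>P. b \<preceq> a \<longrightarrow> b = a}"

lemma exp_le_refl [simp]: "a \<preceq> a"
  by (simp add: exp_le_def)

lemma exp_le_trans: "a \<preceq> b \<Longrightarrow> b \<preceq> c \<Longrightarrow> a \<preceq> c"
  unfolding exp_le_def using le_trans by blast

lemma exp_le_antisym: "a \<preceq> b \<Longrightarrow> b \<preceq> a \<Longrightarrow> a = b"
  by (intro poly_mapping_eqI le_antisym) (simp_all add: exp_le_def)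

lemma exp_le_iff_add: "a \<preceq> b \<longleftrightarrow> (\<exists>c. b = a + c)"
proof
  assume "a \<preceq> b"
  then have "b = a + (b - a)"
    by (intro poly_mapping_eqI) (simp add: exp_le_def lookup_add lookup_minus)
  then show "\<exists>c. b = a + c" ..
qed (auto simp: exp_le_def lookup_add)

lemma total_degree_add: "total_degree (a + b) = total_degree a + total_degree b"
  by (simp add: total_degree_def lookup_add sum.distrib)

lemma total_degree_single [simp]: "total_degree (Poly_Mapping.single i c) = c"
  by (simp add: total_degree_def lookup_single when_def)

lemma total_degree_mono: "a \<preceq> b \<Longrightarrow> total_degree a \<le> total_degree b"
  unfolding total_degree_def exp_le_def by (intro sum_mono) auto

lemma exp_le_eq_if_total_degree:
  assumes "a \<preceq> b" "total_degree b \<le> total_degree a"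
  shows "a = b"
proof -
  obtain c where c: "b = a + c"
    using assms(1) exp_le_iff_add by blast
  with assms(2) have "\<forall>i. Poly_Mapping.lookup c i = 0"
    by (simp add: total_degree_add total_degree_def[of c])
  then have "c = 0" by (intro poly_mapping_eqI) simp
  with c show ?thesis by simp
qed

lemma minimal_exps_below:
  fixes P :: "('n::finite \<Rightarrow>\<^sub>0 nat) set"
  assumes "p \<in> P"
  shows "\<exists>m\<in>minimal_exps P. m \<preceq> p"
  using assms
proof (induction "total_degree p" arbitrary: p rule: less_induct)
  case less
  show ?case
  proof (cases "p \<in> minimal_exps P")
    case True
    then show ?thesis using exp_le_refl by blast
  next
    case False
    then obtain b where b: "b \<in> P" "b \<preceq> p" "b \<noteq> p"
      using less.prems by (auto simp: minimal_exps_def)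
    then have "total_degree b < total_degree p"
      using exp_le_eq_if_total_degree not_le by blast
    with less.hyps b show ?thesis using exp_le_trans by blast
  qed
qed

lemma nat_seq_mono_subseq:
  fixes s :: "nat \<Rightarrow> nat"
  shows "\<exists>r::nat \<Rightarrow> nat. strict_mono r \<and> incseq (\<lambda>n. s (r n))"
proof -
  obtain r :: "nat \<Rightarrow> nat" where r: "strict_mono r" "monoseq (\<lambda>n. s (r n))"
    using seq_monosub by blast
  show ?thesis
  proof (cases "incseq (\<lambda>n. s (r n))")
    case False
    then have dec: "decseq (\<lambda>n. s (r n))"
      using r(2) monoseq_iff by blast
    \<comment> \<open>A decreasing sequence of natural numbers is constant from where it attains its minimum.\<close>
    obtain N where N: "\<And>n. s (r N) \<le> s (r n)"
      using ex_has_least_nat[of "\<lambda>_. True" _ "\<lambda>n. s (r n)"] by auto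
    have "s (r (n + N)) = s (r N)" for n
      using N[of "n + N"] decseqD[OF dec, of N "n + N"] by simp
    then have "incseq (\<lambda>n. s (r (n + N)))" by (simp add: incseq_def)
    moreover have "strict_mono (\<lambda>n. r (n + N))"
      using r(1) by (auto simp: strict_mono_def)
    ultimately show ?thesis by blast
  qed (use r in blast)
qed

text \<open>Refining the subsequence once more for each further coordinate keeps the earlier coordinates
  monotone.\<close>

lemma exp_seq_mono_subseq:
  fixes s :: "nat \<Rightarrow> ('n \<Rightarrow>\<^sub>0 nat)"
  assumes "finite F"
  shows "\<exists>r::nat \<Rightarrow> nat. strict_mono r \<and> (\<forall>i\<in>F. incseq (\<lambda>n. Poly_Mapping.lookup (s (r n)) i))"
  using assms
proof (induction F)
  case empty
  show ?case by (auto intro: strict_mono_id)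
next
  case (insert i F)
  then obtain r :: "nat \<Rightarrow> nat" where r: "strict_mono r"
    "\<forall>i\<in>F. incseq (\<lambda>n. Poly_Mapping.lookup (s (r n)) i)" by blast
  obtain q :: "nat \<Rightarrow> nat" where q: "strict_mono q"
    "incseq (\<lambda>n. Poly_Mapping.lookup (s (r (q n))) i)"
    using nat_seq_mono_subseq[of "\<lambda>n. Poly_Mapping.lookup (s (r n)) i"] by blast
  have "incseq (\<lambda>n. Poly_Mapping.lookup (s (r (q n))) x)" if "x \<in> F" for x
    using r(2) q(1) that by (auto simp: incseq_def strict_mono_less_eq)
  moreover have "strict_mono (\<lambda>n. r (q n))"
    using r(1) q(1) by (auto simp: strict_mono_def)
  ultimately show ?case using q(2) by blast
qed

text \<open>Dickson's lemma: an infinite set of minimal elements would contain an injective sequence, and in a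
  subsequence that is nondecreasing in every coordinate two members are comparable.\<close>

lemma finite_minimal_exps: "finite (minimal_exps (P :: ('n::finite \<Rightarrow>\<^sub>0 nat) set))"
proof (rule ccontr)
  assume "infinite (minimal_exps P)"
  then obtain s :: "nat \<Rightarrow> ('n \<Rightarrow>\<^sub>0 nat)" where s: "inj s" "range s \<subseteq> minimal_exps P"
    using infinite_countable_subset by blast
  obtain r :: "nat \<Rightarrow> nat" where r: "strict_mono r"
    "\<forall>i\<in>UNIV. incseq (\<lambda>n. Poly_Mapping.lookup (s (r n)) i)"
    using exp_seq_mono_subseq[of UNIV s] by auto
  then have "s (r 0) \<preceq> s (r 1)"
    by (auto simp: exp_le_def incseq_def)
  moreover have "s (r 0) \<in> minimal_exps P" "s (r 1) \<in> minimal_exps P"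
    using s(2) by auto
  ultimately have "s (r 0) = s (r 1)"
    by (auto simp: minimal_exps_def)
  then show False
    using injD[OF s(1)] strict_monoD[OF r(1), of 0 1] by force
qed

section \<open>Monomial ideals\<close>

lemma sum_terms:
  fixes f :: "('n, 'k::field) mvpoly"
  shows "f = (\<Sum>p\<in>Poly_Mapping.keys f. Poly_Mapping.single 0 (Poly_Mapping.lookup f p) * monomial p)"
  by (rule poly_mapping_eqI)
    (simp add: monomial_def mult_single lookup_sum lookup_single when_def in_keys_iff)

text \<open>Monomial ideals are spanned, as vector spaces, by the monomials they contain, so ideal membership
  and equality of monomial ideals become questions about exponent vectors.\<close>

lemma in_span_monomials_iff:
  fixes f :: "('n, 'k::field) mvpoly"
  shows "f \<in> ideal.span (monomial ` A) \<longleftrightarrow> (\<forall>p\<in>Poly_Mapping.keys f. \<exists>a\<in>A. a \<preceq> p)"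
proof
  let ?T = "{f :: ('n, 'k) mvpoly. \<forall>b \<in> Poly_Mapping.keys f. \<exists>a\<in>A. a \<preceq> b}"
  have "ideal.subspace ?T"
  proof (rule ideal.subspaceI)
    fix f g :: "('n, 'k) mvpoly"
    show "0 \<in> ?T" by simp
    show "f + g \<in> ?T" if "f \<in> ?T" "g \<in> ?T"
      using that Poly_Mapping.keys_add[of f g] by blast
    show "f * g \<in> ?T" if "g \<in> ?T"
    proof safe
      fix b assume "b \<in> Poly_Mapping.keys (f * g)"
      then obtain p q where pq: "b = p + q" "q \<in> Poly_Mapping.keys g"
        using Poly_Mapping.keys_mult[of f g] by blast
      moreover have "q \<preceq> p + q" by (simp add: exp_le_def lookup_add)
      ultimately show "\<exists>a\<in>A. a \<preceq> b" using that exp_le_trans by blast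
    qed
  qed
  moreover have "monomial ` A \<subseteq> ?T"
    by (auto intro!: bexI[where P="\<lambda>a. a \<preceq> _"])
  ultimately have "ideal.span (monomial ` A) \<subseteq> ?T"
    by (rule ideal.span_minimal[rotated])
  then show "\<forall>p\<in>Poly_Mapping.keys f. \<exists>a\<in>A. a \<preceq> p" if "f \<in> ideal.span (monomial ` A)"
    using that by blast
next
  assume *: "\<forall>p\<in>Poly_Mapping.keys f. \<exists>a\<in>A. a \<preceq> p"
  have "monomial p \<in> ideal.span (monomial ` A :: ('n, 'k) mvpoly set)"
    if p: "p \<in> Poly_Mapping.keys f" for p
  proof -
    obtain a c where "a \<in> A" "p = c + a"
      using * p exp_le_iff_add by (metis add.commute)
    then show ?thesis
      by (simp add: monomial_add ideal.span_scale ideal.span_base)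
  qed
  then show "f \<in> ideal.span (monomial ` A)"
    by (subst sum_terms) (intro ideal.span_sum ideal.span_scale)
qed

lemma span_monomials_eqI:
  assumes "\<And>a. a \<in> A \<Longrightarrow> \<exists>b\<in>B. b \<preceq> a" and "\<And>b. b \<in> B \<Longrightarrow> \<exists>a\<in>A. a \<preceq> b"
  shows "ideal.span (monomial ` A) = ideal.span (monomial ` B :: ('n, 'k::field) mvpoly set)"
proof (intro set_eqI)
  have "(\<exists>a\<in>A. a \<preceq> p) \<longleftrightarrow> (\<exists>b\<in>B. b \<preceq> p)" for p
    using assms exp_le_trans by blast
  then show "f \<in> ideal.span (monomial ` A) \<longleftrightarrow> f \<in> ideal.span (monomial ` B)"
    for f :: "('n, 'k) mvpoly"
    by (simp add: in_span_monomials_iff)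
qed

lemma span_minimal_exps:
  "ideal.span (monomial ` minimal_exps A)
    = ideal.span (monomial ` A :: ('n::finite, 'k::field) mvpoly set)"
proof (rule span_monomials_eqI)
  show "\<exists>b\<in>A. b \<preceq> a" if "a \<in> minimal_exps A" for a
    using that exp_le_refl[of a] unfolding minimal_exps_def by blast
qed (rule minimal_exps_below)

lemma monomial_in_span_iff:
  "(monomial p :: ('n, 'k::field) mvpoly) \<in> ideal.span (monomial ` A) \<longleftrightarrow> (\<exists>a\<in>A. a \<preceq> p)"
  by (simp add: in_span_monomials_iff)

lemma mingens_span_monomials:
  "mingens (ideal.span (monomial ` A :: ('n::finite, 'k::field) mvpoly set))
    = monomial ` minimal_exps A"
proof -
  let ?J = "ideal.span (monomial ` A :: ('n, 'k) mvpoly set)"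
  have "minimal_monomial_generators ?J (monomial ` minimal_exps A)"
    unfolding minimal_monomial_generators_def
  proof (intro conjI allI impI)
    show "ideal.span (monomial ` minimal_exps A) = ?J" by (rule span_minimal_exps)
    fix H :: "('n, 'k) mvpoly set" assume "H \<subset> monomial ` minimal_exps A"
    then obtain B where B: "H = monomial ` B" "B \<subset> minimal_exps A"
      by (auto simp: psubset_eq elim!: subset_imageE)
    then obtain a where a: "a \<in> minimal_exps A" "a \<notin> B" by blast
    have "monomial a \<notin> ideal.span H"
      unfolding B(1) monomial_in_span_iff using a B(2) by (auto simp: minimal_exps_def)
    moreover have "monomial a \<in> ?J"
      using a(1) by (auto simp: minimal_exps_def intro: ideal.span_base)
    ultimately show "ideal.span H \<noteq> ?J" by blast
  qed auto
  moreover have "monomial_ideal ?J" 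
    unfolding monomial_ideal_def by (intro exI[of _ "monomial ` A"] conjI) auto
  ultimately show ?thesis
    unfolding mingens_def by (intro the1_equality ex1_minimal_monomial_generators)
qed

lemma subspace_ideal_colon:
  assumes "ideal.subspace J"
  shows "ideal.subspace (ideal_colon J u)"
  unfolding ideal_colon_def
proof (rule ideal.subspaceI)
  fix f g assume "g \<in> {f. f * u \<in> J}"
  then have "f * (g * u) \<in> J" using ideal.subspace_scale[OF assms] by blast
  then show "f * g \<in> {f. f * u \<in> J}" unfolding mem_Collect_eq mult.assoc .
qed (auto simp: distrib_right ideal.subspace_0[OF assms] intro: ideal.subspace_add[OF assms])

lemma ideal_mult_span:
  fixes X Y :: "'a::comm_ring_1 set"
  shows "ideal_mult (ideal.span X) (ideal.span Y) = ideal.span {x * y | x y. x \<in> X \<and> y \<in> Y}"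
    (is "_ = ?S")
proof
  have 1: "ideal.span Y \<subseteq> ideal_colon ?S x" if "x \<in> X" for x
  proof (rule ideal.span_minimal)
    have "y * x \<in> ?S" if "y \<in> Y" for y
      using that \<open>x \<in> X\<close> by (intro ideal.span_base) (auto simp: mult.commute)
    then show "Y \<subseteq> ideal_colon ?S x" by (auto simp: ideal_colon_def)
  qed (intro subspace_ideal_colon ideal.subspace_span)
  have 2: "ideal.span X \<subseteq> ideal_colon ?S b" if "b \<in> ideal.span Y" for b
  proof (rule ideal.span_minimal)
    show "X \<subseteq> ideal_colon ?S b"
      using 1 that by (force simp: ideal_colon_def mult.commute)
  qed (intro subspace_ideal_colon ideal.subspace_span)
  show "ideal_mult (ideal.span X) (ideal.span Y) \<subseteq> ?S"
    unfolding ideal_mult_def by (rule ideal.span_minimal) (use 2 in \<open>auto simp: ideal_colon_def\<close>)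
  show "?S \<subseteq> ideal_mult (ideal.span X) (ideal.span Y)"
    unfolding ideal_mult_def by (rule ideal.span_mono) (auto intro: ideal.span_base)
qed

lemma ideal_mult_span_monomials:
  "ideal_mult (ideal.span (monomial ` A)) (ideal.span (monomial ` B))
    = ideal.span (monomial ` {a + b | a b. a \<in> A \<and> b \<in> B} :: ('n, 'k::field) mvpoly set)"
proof -
  have "{x * y | x y. x \<in> monomial ` A \<and> y \<in> monomial ` B}
      = (monomial ` {a + b | a b. a \<in> A \<and> b \<in> B} :: ('n, 'k) mvpoly set)"
    by (auto simp: monomial_add image_iff) (metis monomial_add)+
  then show ?thesis by (simp add: ideal_mult_span)
qed

text \<open>Every degree between those of a divisor and of a multiple is attained between them: this is how
  generators of \<open>\<mm>\<^sup>k I\<close> of the exact degree are found below a given monomial.\<close>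

lemma exp_le_total_degree:
  fixes a b :: "'n::finite \<Rightarrow>\<^sub>0 nat"
  assumes "a \<preceq> b" "total_degree a \<le> d" "d \<le> total_degree b"
  shows "\<exists>c. a \<preceq> c \<and> c \<preceq> b \<and> total_degree c = d"
  using assms(2,3,1)
proof (induction d rule: dec_induct)
  case base
  then show ?case using exp_le_refl by blast
next
  case (step d)
  then obtain c where c: "a \<preceq> c" "c \<preceq> b" "total_degree c = d" by auto
  with step.prems have "c \<noteq> b" by auto
  with c(2) obtain i where i: "Poly_Mapping.lookup c i < Poly_Mapping.lookup b i"
    by (metis exp_le_def le_neq_implies_less poly_mapping_eqI)
  let ?c = "c + Poly_Mapping.single i 1"
  have "?c \<preceq> b"
    using c(2) i by (auto simp: exp_le_def lookup_add lookup_single when_def)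
  moreover have "a \<preceq> ?c"
    using c(1) by (auto simp: exp_le_def lookup_add intro: trans_le_add1)
  moreover have "total_degree ?c = Suc d"
    using c(3) by (simp add: total_degree_add)
  ultimately show ?case by blast
qed

lemma max_ideal_power:
  "ideal_power (max_ideal :: ('n::finite, 'k::field) mvpoly set) k
    = ideal.span (monomial ` {c. total_degree c = k})"
proof (induction k)
  case 0
  have "f \<in> ideal.span (monomial ` {c. total_degree c = 0})" for f :: "('n, 'k) mvpoly"
    unfolding in_span_monomials_iff
    by (intro ballI bexI[of _ 0]) (auto simp: exp_le_def total_degree_def)
  then show ?case by auto
next
  case (Suc k)
  let ?V = "range (\<lambda>i::'n. Poly_Mapping.single i (1::nat))"
  have V: "max_ideal = ideal.span (monomial ` ?V :: ('n, 'k) mvpoly set)"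
    by (simp add: max_ideal_def variable_def image_image)
  have "{a + b | a b. a \<in> ?V \<and> b \<in> {c. total_degree c = k}} = {c. total_degree c = Suc k}"
    (is "?L = ?R")
  proof
    show "?L \<subseteq> ?R" by (auto simp: total_degree_add)
    show "?R \<subseteq> ?L"
    proof
      fix c :: "'n \<Rightarrow>\<^sub>0 nat" assume "c \<in> ?R"
      then have c: "total_degree c = Suc k" by simp
      then obtain i where i: "Poly_Mapping.lookup c i > 0"
        by (force simp: total_degree_def)
      then have "Poly_Mapping.single i 1 \<preceq> c"
        by (auto simp: exp_le_def lookup_single when_def)
      then obtain b where b: "c = Poly_Mapping.single i 1 + b"
        using exp_le_iff_add by blast
      with c have "total_degree b = k" by (simp add: total_degree_add)
      with b show "c \<in> ?L" by blast
    qed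
  qed
  then show ?case by (simp only: ideal_power.simps Suc.IH) (simp only: V ideal_mult_span_monomials)
qed

text \<open>The exponents of all monomials in \<open>\<mm>\<^sup>k I\<close>, for \<open>I\<close> generated by the monomials with exponents in
  \<open>A\<close>. This is a larger generating set than the products of generators, but membership in it is a
  plain inequality of degrees.\<close>

definition raised_exps :: "nat \<Rightarrow> ('n::finite \<Rightarrow>\<^sub>0 nat) set \<Rightarrow> ('n \<Rightarrow>\<^sub>0 nat) set" where
  "raised_exps k A = {b. \<exists>a\<in>A. a \<preceq> b \<and> total_degree a + k \<le> total_degree b}"

lemma max_ideal_power_mult:
  "ideal_mult (ideal_power max_ideal k) (ideal.span (monomial ` A))
    = ideal.span (monomial ` raised_exps k A :: ('n::finite, 'k::field) mvpoly set)"
  unfolding max_ideal_power ideal_mult_span_monomials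
proof (rule span_monomials_eqI)
  fix b :: "'n \<Rightarrow>\<^sub>0 nat" assume "b \<in> {c + a |c a. c \<in> {c. total_degree c = k} \<and> a \<in> A}"
  then obtain c a where "b = c + a" "total_degree c = k" "a \<in> A" by blast
  then have "b \<in> raised_exps k A"
    by (auto simp: raised_exps_def total_degree_add exp_le_def lookup_add intro!: bexI[of _ a])
  then show "\<exists>b'\<in>raised_exps k A. b' \<preceq> b" using exp_le_refl by blast
next
  fix b :: "'n \<Rightarrow>\<^sub>0 nat" assume "b \<in> raised_exps k A"
  then obtain a where a: "a \<in> A" "a \<preceq> b" "total_degree a + k \<le> total_degree b"
    by (auto simp: raised_exps_def)
  then obtain c where c: "a \<preceq> c" "c \<preceq> b" "total_degree c = total_degree a + k"
    using exp_le_total_degree[of a b "total_degree a + k"] by auto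
  then obtain e where e: "c = e + a" by (metis add.commute exp_le_iff_add)
  with c(3) have "total_degree e = k" by (simp add: total_degree_add)
  with a(1) c(2) e
  show "\<exists>b'\<in>{c + a |c a. c \<in> {c. total_degree c = k} \<and> a \<in> A}. b' \<preceq> b" by blast
qed

section \<open>Linear quotients of monomial ideals\<close>

lemma lookup_mult_monomial:
  fixes f :: "('n, 'k::field) mvpoly"
  shows "Poly_Mapping.lookup (f * monomial u) (p + u) = Poly_Mapping.lookup f p"
proof -
  have "(\<Sum>q. Poly_Mapping.lookup (monomial u :: ('n, 'k) mvpoly) q when p + u = l + q)
      = (1 when p = l)" for l
  proof -
    have "(Poly_Mapping.lookup (monomial u :: ('n, 'k) mvpoly) q when p + u = l + q)
        = ((1 when p = l) when u = q)" for q
      by (auto simp: monomial_def lookup_single when_def)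
    then show ?thesis by simp
  qed
  then show ?thesis by (simp add: lookup_mult mult_when)
qed

text \<open>The variables \<open>x\<close> for which \<open>x u\<close> lies in the ideal always belong to the colon ideal. Conversely,
  if \<open>x\<^sup>p u\<close> is a multiple of \<open>b\<close>, then \<open>p\<close> is positive at the index \<open>x\<close> given by the hypothesis for \<open>b\<close>,
  since \<open>b\<close> exceeds \<open>u\<close> there.\<close>

lemma ideal_colon_variables:
  fixes u :: "'n \<Rightarrow>\<^sub>0 nat"
  assumes "\<And>b. b \<in> B \<Longrightarrow> \<exists>c\<in>B. \<exists>x. Poly_Mapping.lookup u x < Poly_Mapping.lookup b x \<and>
              c \<preceq> u + Poly_Mapping.single x 1"
  shows "\<exists>V. ideal_colon (ideal.span (monomial ` B)) (monomial u)
           = ideal.span (variable ` V :: ('n, 'k::field) mvpoly set)"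
proof -
  define V where "V = {x. \<exists>c\<in>B. c \<preceq> u + Poly_Mapping.single x 1}"
  let ?J = "ideal.span (monomial ` B) :: ('n, 'k) mvpoly set"
  have var: "variable ` V = (monomial ` (\<lambda>x. Poly_Mapping.single x 1) ` V :: ('n, 'k) mvpoly set)"
    by (simp add: variable_def image_image)
  have "ideal_colon ?J (monomial u) = ideal.span (variable ` V)"
  proof
    show "ideal_colon ?J (monomial u) \<subseteq> ideal.span (variable ` V)"
      unfolding var
    proof (clarsimp simp only: in_span_monomials_iff ideal_colon_def mem_Collect_eq)
      fix f :: "('n, 'k) mvpoly" and p
      assume f: "\<forall>q\<in>Poly_Mapping.keys (f * monomial u). \<exists>b\<in>B. b \<preceq> q"
        and p: "p \<in> Poly_Mapping.keys f"
      have "p + u \<in> Poly_Mapping.keys (f * monomial u)"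
        using p by (simp add: in_keys_iff lookup_mult_monomial)
      with f obtain b where b: "b \<in> B" "b \<preceq> p + u" by blast
      from assms[OF b(1)] obtain x where
        x: "x \<in> V" "Poly_Mapping.lookup u x < Poly_Mapping.lookup b x"
        by (auto simp: V_def)
      from b(2) have "Poly_Mapping.lookup b x \<le> Poly_Mapping.lookup p x + Poly_Mapping.lookup u x"
        by (simp add: exp_le_def lookup_add)
      with x(2) have "Poly_Mapping.single x 1 \<preceq> p"
        by (auto simp: exp_le_def lookup_single when_def)
      with x(1) show "\<exists>a\<in>(\<lambda>x. Poly_Mapping.single x 1) ` V. a \<preceq> p" by blast
    qed
    show "ideal.span (variable ` V) \<subseteq> ideal_colon ?J (monomial u)"
    proof (rule ideal.span_minimal)
      show "variable ` V \<subseteq> ideal_colon ?J (monomial u)"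
      proof
        fix g :: "('n, 'k) mvpoly" assume "g \<in> variable ` V"
        then obtain x where x: "x \<in> V" "g = variable x" by blast
        then have "g * monomial u = monomial (u + Poly_Mapping.single x 1)"
          by (simp add: variable_def monomial_add mult.commute)
        with x(1) show "g \<in> ideal_colon ?J (monomial u)"
          by (simp add: ideal_colon_def V_def monomial_in_span_iff)
      qed
    qed (intro subspace_ideal_colon ideal.subspace_span)
  qed
  then show ?thesis ..
qed

text \<open>Sorting the generators by a key turns the condition on positions into one on keys. Generators with
  equal keys may come in either order, so \<open>v\<close> ranges over all other generators with key at most that of
  \<open>u\<close>, while the witness must have a strictly smaller key to be certain to precede \<open>u\<close>.\<close>

lemma linear_quotients_by_key:
  fixes P :: "('n::finite \<Rightarrow>\<^sub>0 nat) set" and key :: "('n \<Rightarrow>\<^sub>0 nat) \<Rightarrow> 'l::linorder"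
  assumes "\<And>u v. u \<in> minimal_exps P \<Longrightarrow> v \<in> minimal_exps P \<Longrightarrow> v \<noteq> u \<Longrightarrow> key v \<le> key u \<Longrightarrow>
     \<exists>w\<in>minimal_exps P. key w < key u \<and>
       (\<exists>x. Poly_Mapping.lookup u x < Poly_Mapping.lookup v x \<and> w \<preceq> u + Poly_Mapping.single x 1)"
  shows "linear_quotients (ideal.span (monomial ` P :: ('n, 'k::field) mvpoly set))"
proof -
  obtain bs0 where "set bs0 = minimal_exps P" "distinct bs0"
    using finite_distinct_list[OF finite_minimal_exps] by blast
  then obtain bs where bs: "set bs = minimal_exps P" "distinct bs" "sorted (map key bs)"
    by (metis distinct_sort set_sort sorted_sort_key)
  let ?us = "map monomial bs :: ('n, 'k) mvpoly list"
  have inj: "inj (monomial :: _ \<Rightarrow> ('n, 'k) mvpoly)"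
    by (rule injI) (metis keys_monomial singleton_inject)
  have colon: "\<exists>V. ideal_colon (ideal.span (set (take i ?us))) (?us ! i)
      = ideal.span (variable ` V :: ('n, 'k) mvpoly set)" if i: "i < length bs" for i
  proof -
    have "\<exists>w\<in>set (take i bs). \<exists>x. Poly_Mapping.lookup (bs ! i) x < Poly_Mapping.lookup v x \<and>
        w \<preceq> bs ! i + Poly_Mapping.single x 1" if v: "v \<in> set (take i bs)" for v
    proof -
      obtain j where j: "j < i" "v = bs ! j"
        using v i by (auto simp: in_set_conv_nth)
      have "v \<noteq> bs ! i" using j i bs(2) by (simp add: nth_eq_iff_index_eq)
      moreover have "key v \<le> key (bs ! i)"
        using sorted_nth_mono[OF bs(3), of j i] j i by simp
      moreover have "v \<in> minimal_exps P" "bs ! i \<in> minimal_exps P"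
        using bs(1) i v in_set_takeD by fastforce+
      ultimately obtain w x where w: "w \<in> set bs" "key w < key (bs ! i)"
        "Poly_Mapping.lookup (bs ! i) x < Poly_Mapping.lookup v x"
        "w \<preceq> bs ! i + Poly_Mapping.single x 1"
        using assms bs(1) by blast
      from w(1) obtain l where l: "l < length bs" "w = bs ! l"
        by (auto simp: in_set_conv_nth)
      have "l < i"
        using sorted_nth_mono[OF bs(3), of i l] l w(2) by (auto simp: not_le[symmetric])
      with l i have "w \<in> set (take i bs)"
        by (auto simp: in_set_conv_nth intro!: exI[of _ l])
      with w show ?thesis by blast
    qed
    from ideal_colon_variables[of "set (take i bs)" "bs ! i", OF this] i
    show ?thesis by (simp add: take_map)
  qed
  show ?thesis
    unfolding linear_quotients_def mingens_span_monomials
  proof (intro exI[of _ ?us] conjI allI impI)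
    show "distinct ?us"
      using bs(2) inj_on_subset[OF inj subset_UNIV] by (simp add: distinct_map)
    show "set ?us = monomial ` minimal_exps P"
      using bs(1) by simp
    show "\<exists>V. ideal_colon (ideal.span (set (take i ?us))) (?us ! i) = ideal.span (variable ` V)"
      if "1 \<le> i \<and> i < length ?us" for i
      using that by (intro colon) simp
  qed
qed

section \<open>The order on the generators\<close>

definition truncated_degree :: "nat \<Rightarrow> ('n::finite \<Rightarrow>\<^sub>0 nat) \<Rightarrow> nat" where
  "truncated_degree M u = (\<Sum>i\<in>UNIV. min (Poly_Mapping.lookup u i) M)"

text \<open>The keys are compared lexicographically; the two negations make larger truncated degrees and larger
  weighted sums come first.\<close>

definition gen_key :: "nat \<Rightarrow> ('n::finite \<Rightarrow> nat) \<Rightarrow> ('n \<Rightarrow>\<^sub>0 nat) \<Rightarrow> nat \<times> int \<times> int" where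
  "gen_key M w u = (total_degree u, - int (truncated_degree M u),
     - (\<Sum>i\<in>UNIV. int (w i) * int (Poly_Mapping.lookup u i)))"

text \<open>Passing from a monomial to a minimal generator dividing it never moves to a later place in the
  order, because the degree is compared first.\<close>

lemma gen_key_mono:
  assumes "v \<preceq> u"
  shows "gen_key M w v \<le> gen_key M w u"
proof (cases "total_degree v < total_degree u")
  case True
  then show ?thesis by (simp add: gen_key_def)
next
  case False
  with assms have "v = u" by (simp add: exp_le_eq_if_total_degree)
  then show ?thesis by simp
qed

text \<open>If the conclusion fails, every index where \<open>d\<close> is positive has smaller weight than every index
  where \<open>d\<close> is negative. Let \<open>c\<close> be the largest weight on the positive part. Replacing the weights
  \<open>w\<^sub>i\<close> by \<open>w\<^sub>i - c\<close> does not change the weighted sum, because \<open>d\<close> sums to zero, but makes all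
  its terms nonpositive and at least one negative.\<close>

lemma weighted_exchange:
  fixes d :: "'n::finite \<Rightarrow> int" and w :: "'n \<Rightarrow> nat"
  assumes "inj w" "sum d UNIV = 0" "d x \<noteq> 0" "(\<Sum>i\<in>UNIV. int (w i) * d i) \<ge> 0"
  shows "\<exists>i j. d i > 0 \<and> d j < 0 \<and> w j < w i"
proof (rule ccontr)
  assume none: "\<not> ?thesis"
  have less: "w i < w j" if "d i > 0" "d j < 0" for i j
  proof -
    have "i \<noteq> j" using that by auto
    then have "w i \<noteq> w j" using injD[OF assms(1)] by blast
    with none that show ?thesis by (meson linorder_neqE_nat)
  qed
  have "\<exists>i. d i > 0"
  proof (rule ccontr)
    assume "\<not> ?thesis"
    then have "\<And>i. - d i \<ge> 0" by (simp add: not_less)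
    then have "- d x = 0"
      using sum_nonneg_eq_0_iff[of UNIV "\<lambda>i. - d i"] assms(2) by (simp add: sum_negf)
    with assms(3) show False by simp
  qed
  have "\<exists>j. d j < 0"
  proof (rule ccontr)
    assume "\<not> ?thesis"
    then have "\<And>i. d i \<ge> 0" by (simp add: not_less)
    then have "d x = 0"
      using sum_nonneg_eq_0_iff[of UNIV d] assms(2) by simp
    with assms(3) show False by simp
  qed
  then obtain j where j: "d j < 0" ..
  define c where "c = Max (w ` {i. d i > 0})"
  have c_ge: "w i \<le> c" if "d i > 0" for i
    unfolding c_def using that by (intro Max_ge) auto
  have "c \<in> w ` {i. d i > 0}"
    unfolding c_def using \<open>\<exists>i. d i > 0\<close> by (intro Max_in) auto
  then obtain i where i: "d i > 0" "c = w i" by auto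
  have c_less: "c < w j" if "d j < 0" for j
    using less[OF i(1) that] i(2) by simp
  have "(\<Sum>i\<in>UNIV. (int (w i) - int c) * d i) < (\<Sum>i\<in>(UNIV::'n set). 0)"
  proof (rule sum_strict_mono_ex1)
    show "\<forall>i\<in>UNIV. (int (w i) - int c) * d i \<le> 0"
    proof
      fix i
      show "(int (w i) - int c) * d i \<le> 0"
      proof (cases "d i > 0")
        case True
        then show ?thesis using c_ge[of i] by (intro mult_nonpos_nonneg) auto
      next
        case False
        then show ?thesis using c_less[of i] by (cases "d i = 0") (auto intro!: mult_nonneg_nonpos)
      qed
    qed
    show "\<exists>i\<in>UNIV. (int (w i) - int c) * d i < 0"
      using j c_less[OF j] by (intro bexI[of _ j] mult_pos_neg) auto
  qed simp
  moreover have "(\<Sum>i\<in>UNIV. (int (w i) - int c) * d i)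
      = (\<Sum>i\<in>UNIV. int (w i) * d i) - int c * sum d UNIV"
    by (simp add: left_diff_distrib sum_subtractf sum_distrib_left)
  ultimately show False using assms(2,4) by simp
qed

lemma large_exponent:
  fixes u :: "'n::finite \<Rightarrow>\<^sub>0 nat"
  assumes "card (UNIV :: 'n set) * M < total_degree u"
  shows "\<exists>j. M < Poly_Mapping.lookup u j"
proof (rule ccontr)
  assume "\<not> ?thesis"
  then have "total_degree u \<le> (\<Sum>i\<in>(UNIV::'n set). M)"
    unfolding total_degree_def by (intro sum_mono) (auto simp: not_less)
  with assms show False by simp
qed

text \<open>The exchange \<open>x\<^sub>i u / x\<^sub>j\<close>. It stays in \<open>\<mm>\<^sup>k I\<close> because the exponent at \<open>j\<close> remains at least \<open>M\<close>, and
  it comes before \<open>u\<close> because it either raises the truncated degree, or keeps it and raises the weighted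
  sum. It need not be a minimal generator, but any minimal generator dividing it comes at least as
  early.\<close>

lemma raised_exps_exchange:
  fixes u :: "'n::finite \<Rightarrow>\<^sub>0 nat"
  assumes bound: "\<And>a i. a \<in> A \<Longrightarrow> Poly_Mapping.lookup a i \<le> M"
    and u: "u \<in> raised_exps k A" and j: "M < Poly_Mapping.lookup u j" and ij: "i \<noteq> j"
    and better: "Poly_Mapping.lookup u i < M \<or> M \<le> Poly_Mapping.lookup u i \<and> w j < w i"
  shows "\<exists>m\<in>minimal_exps (raised_exps k A).
           gen_key M w m < gen_key M w u \<and> m \<preceq> u + Poly_Mapping.single i 1"
proof -
  define t where "t = u + Poly_Mapping.single i 1 - Poly_Mapping.single j 1"
  have t: "Poly_Mapping.lookup t x = (if x = i then Suc (Poly_Mapping.lookup u x)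
      else if x = j then Poly_Mapping.lookup u x - 1 else Poly_Mapping.lookup u x)" for x
    using ij by (auto simp: t_def lookup_add lookup_minus lookup_single when_def)
  have "t + Poly_Mapping.single j 1 = u + Poly_Mapping.single i 1"
    using ij j by (intro poly_mapping_eqI) (auto simp: lookup_add lookup_single when_def t)
  then have deg: "total_degree t = total_degree u"
    by (metis add_right_cancel total_degree_add total_degree_single)
  obtain a where a: "a \<in> A" "a \<preceq> u" "total_degree a + k \<le> total_degree u"
    using u by (auto simp: raised_exps_def)
  have "a \<preceq> t"
    unfolding exp_le_def
  proof
    fix x
    show "Poly_Mapping.lookup a x \<le> Poly_Mapping.lookup t x"
      using a(2) bound[OF a(1), of x] j unfolding exp_le_def t
      by (auto intro: le_SucI)
  qed
  with a deg have "t \<in> raised_exps k A"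
    by (auto simp: raised_exps_def)
  then obtain m where m: "m \<in> minimal_exps (raised_exps k A)" "m \<preceq> t"
    using minimal_exps_below by blast
  have tu: "t \<preceq> u + Poly_Mapping.single i 1"
    by (auto simp: exp_le_def t lookup_add lookup_single when_def)
  have "gen_key M w t < gen_key M w u"
  proof (cases "Poly_Mapping.lookup u i < M")
    case True
    have "truncated_degree M u < truncated_degree M t"
      unfolding truncated_degree_def
      by (rule sum_strict_mono_ex1) (use True j in \<open>auto simp: t intro!: bexI[of _ i]\<close>)
    with deg show ?thesis by (simp add: gen_key_def)
  next
    case False
    with better have w: "M \<le> Poly_Mapping.lookup u i" "w j < w i" by auto
    have trunc: "truncated_degree M t = truncated_degree M u"
      unfolding truncated_degree_def
      by (rule sum.cong) (use w(1) j in \<open>auto simp: t\<close>)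
    have "int (w x) * int (Poly_Mapping.lookup t x) = int (w x) * int (Poly_Mapping.lookup u x)
        + (if x = i then int (w i) else 0) - (if x = j then int (w j) else 0)" for x
      using ij j by (auto simp: t algebra_simps of_nat_diff)
    then have "(\<Sum>x\<in>UNIV. int (w x) * int (Poly_Mapping.lookup t x))
        = (\<Sum>x\<in>UNIV. int (w x) * int (Poly_Mapping.lookup u x)) + int (w i) - int (w j)"
      by (simp add: sum.distrib sum_subtractf)
    with deg trunc w(2) show ?thesis by (simp add: gen_key_def)
  qed
  with m tu show ?thesis
    using gen_key_mono[OF m(2), of M w] exp_le_trans by (intro bexI[of _ m]) auto
qed

text \<open>A monomial of larger degree would be a proper multiple of a monomial of degree \<open>deg a + k\<close> that is
  itself divisible by \<open>a\<close>. The lemma holds for every divisor \<open>a\<close> of \<open>u\<close> in \<open>A\<close>, which is what excludes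
  earlier generators of smaller degree with dominated truncation.\<close>

lemma minimal_raised_degree:
  assumes "u \<in> minimal_exps (raised_exps k A)" "a \<in> A" "a \<preceq> u"
  shows "total_degree u \<le> total_degree a + k"
proof (rule ccontr)
  assume less: "\<not> ?thesis"
  then obtain c where c: "a \<preceq> c" "c \<preceq> u" "total_degree c = total_degree a + k"
    using exp_le_total_degree[of a u "total_degree a + k"] assms(3) by auto
  then have "c \<in> raised_exps k A"
    using assms(2) by (auto simp: raised_exps_def)
  with assms(1) c(2) have "c = u" by (auto simp: minimal_exps_def)
  with c(3) less show False by simp
qed

lemma raised_exps_linear_step:
  fixes u v :: "'n::finite \<Rightarrow>\<^sub>0 nat"
  assumes bound: "\<And>a i. a \<in> A \<Longrightarrow> Poly_Mapping.lookup a i \<le> M"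
    and k: "card (UNIV :: 'n set) * M < k" and w: "inj w"
    and u: "u \<in> minimal_exps (raised_exps k A)" and v: "v \<in> minimal_exps (raised_exps k A)"
    and ne: "v \<noteq> u" and key: "gen_key M w v \<le> gen_key M w u"
  shows "\<exists>m\<in>minimal_exps (raised_exps k A). gen_key M w m < gen_key M w u \<and>
           (\<exists>x. Poly_Mapping.lookup u x < Poly_Mapping.lookup v x \<and>
             m \<preceq> u + Poly_Mapping.single x 1)"
proof -
  have uR: "u \<in> raised_exps k A" and vR: "v \<in> raised_exps k A"
    using u v by (auto simp: minimal_exps_def)
  show ?thesis
  proof (cases "\<exists>i. Poly_Mapping.lookup u i < Poly_Mapping.lookup v i \<and> Poly_Mapping.lookup u i < M")
    case True
    then obtain i where i: "Poly_Mapping.lookup u i < Poly_Mapping.lookup v i"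
      "Poly_Mapping.lookup u i < M" by blast
    have "k \<le> total_degree u" using uR by (auto simp: raised_exps_def)
    with k obtain j where j: "M < Poly_Mapping.lookup u j"
      using large_exponent[of M u] by auto
    with i have "i \<noteq> j" by auto
    with raised_exps_exchange[OF bound uR j, of i w] i show ?thesis by blast
  next
    case False
    then have le: "min (Poly_Mapping.lookup v i) M \<le> min (Poly_Mapping.lookup u i) M" for i
      by (metis linorder_le_less_linear min.absorb2 min.bounded_iff min.cobounded2 min.mono order_refl)
    obtain b where b: "b \<in> A" "b \<preceq> v" "total_degree b + k \<le> total_degree v"
      using vR by (auto simp: raised_exps_def)
    \<comment> \<open>All exponents of \<open>b\<close> are at most \<open>M\<close>, so \<open>b\<close> already divides the truncation of \<open>v\<close>.\<close>
    have "b \<preceq> u"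
      unfolding exp_le_def
    proof
      fix i
      show "Poly_Mapping.lookup b i \<le> Poly_Mapping.lookup u i"
        using le[of i] bound[OF b(1), of i] b(2) unfolding exp_le_def
        by (metis min.bounded_iff order_trans)
    qed
    with u b have "total_degree u \<le> total_degree v"
      using minimal_raised_degree by (meson order_trans)
    with key have deg: "total_degree v = total_degree u"
      and trunc: "truncated_degree M u \<le> truncated_degree M v"
      by (auto simp: gen_key_def)
    have eq: "min (Poly_Mapping.lookup v i) M = min (Poly_Mapping.lookup u i) M" for i
    proof (rule ccontr)
      assume "\<not> ?thesis"
      with le[of i] have "truncated_degree M v < truncated_degree M u"
        unfolding truncated_degree_def
        by (intro sum_strict_mono_ex1)
          (use le in \<open>auto simp del: min.bounded_iff min_less_iff_conj
            intro!: bexI[of _ i] le_neq_trans\<close>)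
      with trunc show False by simp
    qed
    then have "truncated_degree M v = truncated_degree M u"
      by (simp add: truncated_degree_def)
    with key deg have weight: "(\<Sum>i\<in>UNIV. int (w i) * int (Poly_Mapping.lookup u i))
        \<le> (\<Sum>i\<in>UNIV. int (w i) * int (Poly_Mapping.lookup v i))"
      by (simp add: gen_key_def)
    \<comment> \<open>Since the truncations agree, \<open>d\<close> vanishes wherever an exponent of \<open>u\<close> is below \<open>M\<close>.\<close>
    define d where "d i = int (Poly_Mapping.lookup v i) - int (Poly_Mapping.lookup u i)" for i
    obtain x where "d x \<noteq> 0"
      using ne by (auto simp: d_def intro: poly_mapping_eqI)
    moreover have "sum d UNIV = 0"
      using deg by (simp add: d_def sum_subtractf total_degree_def flip: of_nat_sum)
    moreover have "(\<Sum>i\<in>UNIV. int (w i) * d i) \<ge> 0"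
      using weight by (simp add: d_def right_diff_distrib sum_subtractf)
    ultimately obtain i j where ij: "d i > 0" "d j < 0" "w j < w i"
      using weighted_exchange[OF w] by blast
    have i: "Poly_Mapping.lookup u i < Poly_Mapping.lookup v i" "M \<le> Poly_Mapping.lookup u i"
      using ij(1) eq[of i] by (auto simp: d_def min_def split: if_splits)
    have j: "M < Poly_Mapping.lookup u j"
      using ij(2) eq[of j] by (auto simp: d_def min_def split: if_splits)
    have "i \<noteq> j" using ij by auto
    with raised_exps_exchange[OF bound uR j, of i w] i ij(3) show ?thesis by blast
  qed
qed

theorem theorem1p5:
  fixes I :: "('n::finite, 'k::field) mvpoly set"
  assumes "monomial_ideal I"
  shows "\<exists>k0::nat. \<forall>k\<ge>k0. linear_quotients (ideal_mult (ideal_power max_ideal k) I)"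
proof -
  obtain A0 where "I = ideal.span (monomial ` A0)"
    using assms by (auto simp: monomial_ideal_def elim!: subset_imageE)
  then obtain A where A: "finite A" "I = ideal.span (monomial ` A)"
    using span_minimal_exps finite_minimal_exps by metis
  \<comment> \<open>The zero covers the case that \<open>A\<close> is empty, where \<open>I\<close> is the zero ideal.\<close>
  define M where "M = Max (insert 0 (\<Union>a\<in>A. range (Poly_Mapping.lookup a)))"
  have bound: "Poly_Mapping.lookup a i \<le> M" if "a \<in> A" for a i
    unfolding M_def using A(1) that by (intro Max_ge) auto
  obtain w :: "'n \<Rightarrow> nat" where w: "inj w"
    using finite_imp_inj_to_nat_seg[OF finite_UNIV] by blast
  have "linear_quotients (ideal_mult (ideal_power max_ideal k) I)"
    if "Suc (card (UNIV :: 'n set) * M) \<le> k" for k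
    unfolding A(2) max_ideal_power_mult
    by (rule linear_quotients_by_key[where key = "gen_key M w"],
        rule raised_exps_linear_step[OF bound _ w]) (use that in auto)
  then show ?thesis by blast
qed

end
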